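(* Let $\mathbb{D}\subset\mathbb{C}$ be the unit disc, let $\Omega\subset\mathbb{C}$ be a domain, and let $\varphi:\mathbb{D}\to\Omega$ be a conformal homeomorphism (onto $\Omega$). Suppose that for some $s>2$ the complex derivative $\varphi'$ is integrable in the degree $s$, i.e. $$\iint_{\mathbb{D}}|\varphi'(z)|^s\,dx\,dy<+\infty .$$ Then $\Omega$ has finite geodesic diameter.
   Context: A domain is a nonempty connected open set. A homeomorphism $\varphi:\Omega_1\to\Omega_2$ between domains in $\mathbb{C}$ is called conformal if it is a diffeomorphism and $|\varphi'(z)|^2=J(z,\varphi)$ for all $z\in\Omega_1$, where $J(z,\varphi)$ is the Jacobian determinant of $\varphi$ at $z$; equivalently, $\varphi$ is a biholomorphic bijection. The geodesic diameter of a domain $\Omega\subset\mathbb{C}=\mathbb{R}^2$ is $\sup_{x,y\in\Omega}\operatorname{dist}_\Omega(x,y)$, where $\operatorname{dist}_\Omega(x,y)$ is the intrinsic geodesic distance: the infimum of the lengths $\int_0^1|\gamma'(t)|\,dt$ over all rectifiable curves $\gamma:[0,1]\to\Omega$ with $\gamma(0)=x$, $\gamma(1)=y$. *)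

theory Defs
  imports "HOL-Complex_Analysis.Complex_Analysis"
begin

definition domain_in_C :: "complex set \<Rightarrow> bool" where
  "domain_in_C \<Omega> \<longleftrightarrow> open \<Omega> \<and> connected \<Omega> \<and> \<Omega> \<noteq> {}"

definition C1_on :: "complex set \<Rightarrow> (complex \<Rightarrow> complex) \<Rightarrow> bool" where
  "C1_on S f \<longleftrightarrow> (\<exists>D :: complex \<Rightarrow> complex \<Rightarrow>\<^sub>L complex.
      continuous_on S D \<and> (\<forall>z\<in>S. (f has_derivative blinfun_apply (D z)) (at z)))"

definition jacobian_det :: "(complex \<Rightarrow> complex) \<Rightarrow> complex \<Rightarrow> real" where
  "jacobian_det f z = (let D = frechet_derivative f (at z)
     in Re (D 1) * Im (D \<i>) - Re (D \<i>) * Im (D 1))"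

text \<open>
  Here \<open>f'\<close> in \<open>|f'(z)|\<^sup>2 = J(z, f)\<close> is the real differential, measured in the operator norm; the
  lemma \<open>conformal_homeomorphism_iff\<close> below identifies these maps with the biholomorphic bijections.
\<close>
definition conformal_homeomorphism ::
    "complex set \<Rightarrow> complex set \<Rightarrow> (complex \<Rightarrow> complex) \<Rightarrow> bool" where
  "conformal_homeomorphism \<Omega>1 \<Omega>2 f \<longleftrightarrow>
     (\<exists>g. homeomorphism \<Omega>1 \<Omega>2 f g \<and> C1_on \<Omega>1 f \<and> C1_on \<Omega>2 g) \<and>
     (\<forall>z\<in>\<Omega>1. (onorm (frechet_derivative f (at z)))\<^sup>2 = jacobian_det f z)"

text \<open>
  The elements of a division are nonempty compact intervals \<open>[a, b]\<close> with disjoint interiors, so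
  \<open>Inf K\<close> and \<open>Sup K\<close> are the endpoints of \<open>K\<close>.
\<close>
definition rectifiable_path :: "(real \<Rightarrow> complex) \<Rightarrow> bool" where
  "rectifiable_path \<gamma> \<longleftrightarrow> path \<gamma> \<and>
     (\<exists>B. \<forall>\<D>. \<D> division_of {0..1} \<longrightarrow> (\<Sum>K\<in>\<D>. norm (\<gamma> (Sup K) - \<gamma> (Inf K))) \<le> B)"

definition absolutely_continuous_path :: "(real \<Rightarrow> complex) \<Rightarrow> bool" where
  "absolutely_continuous_path \<gamma> \<longleftrightarrow>
     (\<forall>\<epsilon>>0. \<exists>\<delta>>0. \<forall>\<D> T. \<D> division_of T \<and> T \<subseteq> {0..1} \<and> (\<Sum>K\<in>\<D>. Sup K - Inf K) < \<delta> \<longrightarrow>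
        (\<Sum>K\<in>\<D>. norm (\<gamma> (Sup K) - \<gamma> (Inf K))) < \<epsilon>)"

text \<open>
  An absolutely continuous path is differentiable only almost everywhere; as \<open>lebesgue\<close> is complete,
  the values of \<open>vector_derivative\<close> on the exceptional null set are irrelevant.
\<close>
definition path_length :: "(real \<Rightarrow> complex) \<Rightarrow> ennreal" where
  "path_length \<gamma> = (\<integral>\<^sup>+t\<in>{0..1}. ennreal (norm (vector_derivative \<gamma> (at t))) \<partial>lebesgue)"

text \<open>
  The integral of \<open>|\<gamma>'|\<close> is the length of a rectifiable curve only for absolutely continuous
  parametrisations (arc length always provides one). For a Cantor-type parametrisation of a segment
  the integral is \<open>0\<close>, so without that condition all distances in a domain would vanish.
\<close>
definition geodesic_dist :: "complex set \<Rightarrow> complex \<Rightarrow> complex \<Rightarrow> ennreal" where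
  "geodesic_dist \<Omega> x y =
     (INF \<gamma> \<in> {\<gamma>. rectifiable_path \<gamma> \<and> absolutely_continuous_path \<gamma> \<and> path_image \<gamma> \<subseteq> \<Omega> \<and>
                   pathstart \<gamma> = x \<and> pathfinish \<gamma> = y}. path_length \<gamma>)"

definition geodesic_diameter :: "complex set \<Rightarrow> ennreal" where
  "geodesic_diameter \<Omega> = (SUP x\<in>\<Omega>. SUP y\<in>\<Omega>. geodesic_dist \<Omega> x y)"

lemma holomorphic_imp_C1_on:
  assumes "f holomorphic_on S" "open S"
  shows "C1_on S f"
  unfolding C1_on_def
proof (intro exI conjI ballI)
  show "continuous_on S (\<lambda>z. blinfun_mult_right (deriv f z))"
    by (intro bounded_linear.continuous_on[OF bounded_linear_blinfun_mult_right]
          holomorphic_on_imp_continuous_on holomorphic_deriv assms)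
  show "(f has_derivative blinfun_apply (blinfun_mult_right (deriv f z))) (at z)" if "z \<in> S" for z
    using holomorphic_derivI[OF assms that]
    by (simp add: has_field_derivative_def blinfun_mult_right.rep_eq)
qed

lemma onorm_sq_eq_det_imp_complex_linear:
  fixes D :: "complex \<Rightarrow> complex"
  assumes D: "bounded_linear D"
    and eq: "(onorm D)\<^sup>2 = Re (D 1) * Im (D \<i>) - Re (D \<i>) * Im (D 1)"
  shows "D = (*) (D 1)"
proof -
  interpret bounded_linear D by (rule D)
  define a b c d where "a = Re (D 1)" and "b = Im (D 1)" and "c = Re (D \<i>)" and "d = Im (D \<i>)"
  have "norm (D 1) \<le> onorm D" "norm (D \<i>) \<le> onorm D"
    using onorm[OF D, of 1] onorm[OF D, of \<i>] by simp_all
  then have "(norm (D 1))\<^sup>2 \<le> (onorm D)\<^sup>2" "(norm (D \<i>))\<^sup>2 \<le> (onorm D)\<^sup>2"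
    by (simp_all add: power_mono)
  then have "a\<^sup>2 + b\<^sup>2 \<le> a * d - c * b" "c\<^sup>2 + d\<^sup>2 \<le> a * d - c * b"
    by (simp_all add: cmod_power2 eq a_def b_def c_def d_def)
  then have "(a - d)\<^sup>2 + (b + c)\<^sup>2 \<le> 0"
    by (simp add: power2_eq_square algebra_simps)
  then have "a - d = 0" "b + c = 0"
    using sum_power2_le_zero_iff by blast+
  then have Di: "D \<i> = \<i> * D 1"
    by (simp add: complex_eq_iff a_def b_def c_def d_def)
  show ?thesis
  proof
    fix z
    have "z = Re z *\<^sub>R 1 + Im z *\<^sub>R \<i>"
      by (simp add: complex_eq_iff)
    then have "D z = D (Re z *\<^sub>R 1 + Im z *\<^sub>R \<i>)"
      by (rule arg_cong)
    also have "\<dots> = Re z *\<^sub>R D 1 + Im z *\<^sub>R D \<i>"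
      by (simp add: add scaleR)
    also have "\<dots> = D 1 * z"
      by (simp add: Di complex_eq_iff algebra_simps)
    finally show "D z = D 1 * z" .
  qed
qed

lemma conformal_homeomorphism_iff:
  assumes "open \<Omega>1"
  shows "conformal_homeomorphism \<Omega>1 \<Omega>2 f \<longleftrightarrow>
    f holomorphic_on \<Omega>1 \<and> inj_on f \<Omega>1 \<and> f ` \<Omega>1 = \<Omega>2"
proof
  assume *: "conformal_homeomorphism \<Omega>1 \<Omega>2 f"
  then obtain g where hom: "homeomorphism \<Omega>1 \<Omega>2 f g" and C1: "C1_on \<Omega>1 f"
    unfolding conformal_homeomorphism_def by blast
  have "f field_differentiable at z" if z: "z \<in> \<Omega>1" for z
  proof -
    let ?D = "frechet_derivative f (at z)"
    have "f differentiable at z"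
      using C1 z unfolding C1_on_def differentiable_def by blast
    then have D: "(f has_derivative ?D) (at z)"
      by (simp add: frechet_derivative_works)
    have "(onorm ?D)\<^sup>2 = Re (?D 1) * Im (?D \<i>) - Re (?D \<i>) * Im (?D 1)"
      using * z unfolding conformal_homeomorphism_def jacobian_det_def Let_def by blast
    with D have "?D = (*) (?D 1)"
      by (intro onorm_sq_eq_det_imp_complex_linear has_derivative_bounded_linear)
    with D show ?thesis
      unfolding field_differentiable_def has_field_derivative_def by metis
  qed
  then have "f holomorphic_on \<Omega>1"
    by (simp add: holomorphic_on_def field_differentiable_at_within)
  moreover have "inj_on f \<Omega>1"
    using hom by (metis homeomorphism_apply1 inj_on_def)
  ultimately show "f holomorphic_on \<Omega>1 \<and> inj_on f \<Omega>1 \<and> f ` \<Omega>1 = \<Omega>2"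
    using hom by (simp add: homeomorphism_image1)
next
  assume "f holomorphic_on \<Omega>1 \<and> inj_on f \<Omega>1 \<and> f ` \<Omega>1 = \<Omega>2"
  then have hol: "f holomorphic_on \<Omega>1" and inj: "inj_on f \<Omega>1" and im: "f ` \<Omega>1 = \<Omega>2"
    by auto
  obtain g where g: "g holomorphic_on \<Omega>2" and gf: "\<And>z. z \<in> \<Omega>1 \<Longrightarrow> g (f z) = z"
    using holomorphic_has_inverse[OF hol assms inj] im by metis
  have "open \<Omega>2"
    using open_mapping_thm3[OF hol assms inj] im by simp
  have "homeomorphism \<Omega>1 \<Omega>2 f g"
    using hol g gf im by (auto simp: homeomorphism_def holomorphic_on_imp_continuous_on image_iff)
  moreover have "C1_on \<Omega>1 f" "C1_on \<Omega>2 g"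
    using holomorphic_imp_C1_on hol g assms \<open>open \<Omega>2\<close> by auto
  moreover have "(onorm (frechet_derivative f (at z)))\<^sup>2 = jacobian_det f z" if "z \<in> \<Omega>1" for z
  proof -
    have "(f has_derivative (*) (deriv f z)) (at z)"
      using holomorphic_derivI[OF hol assms that] by (simp add: has_field_derivative_def)
    then have D: "frechet_derivative f (at z) = (*) (deriv f z)"
      by (metis frechet_derivative_at)
    have "onorm ((*) (deriv f z)) = norm (deriv f z)"
    proof (rule antisym)
      show "onorm ((*) (deriv f z)) \<le> norm (deriv f z)"
        by (rule onorm_bound) (simp_all add: norm_mult)
      show "norm (deriv f z) \<le> onorm ((*) (deriv f z))"
        using onorm[OF bounded_linear_mult_right[of "deriv f z"], of 1] by simp
    qed
    then show ?thesis
      by (simp add: D jacobian_det_def cmod_power2) (simp add: power2_eq_square)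
  qed
  ultimately show "conformal_homeomorphism \<Omega>1 \<Omega>2 f"
    unfolding conformal_homeomorphism_def by blast
qed

end

theory Submission
  imports Defs
begin

text \<open>
  The area mean value inequality on the disc of radius \<open>1 - |z|\<close> about \<open>z\<close>, combined with Young's
  inequality, turns \<open>L\<^sup>s\<close>-integrability of \<open>\<phi>'\<close> into the growth bound
  \<open>|\<phi>'(z)| \<le> C (1 - |z|) powr -(2/s)\<close>. As \<open>2/s < 1\<close>, this bound is integrable along radii,
  so the images of the broken paths from \<open>x\<close> to \<open>y\<close> through \<open>0\<close> have uniformly bounded length.
\<close>

section \<open>Rotation invariance of Lebesgue measure on the complex plane\<close>

text \<open>Transports statements to \<open>real^2\<close>, where orthogonal transformations are
  known to preserve measure. Both measures agree on boxes, since the preimage of a box is the box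
  with the same side lengths.\<close>

lemma lborel_complex_eq_distr_vec:
  "(lborel :: complex measure) = distr lborel borel (\<lambda>v::real^2. Complex (v $ 1) (v $ 2))"
proof (rule lborel_eqI)
  let ?g = "\<lambda>v::real^2. Complex (v $ 1) (v $ 2)"
  have [measurable]: "?g \<in> borel_measurable borel"
    by (intro borel_measurable_continuous_onI) (simp add: Complex_eq continuous_intros)
  fix l u :: complex
  assume le: "\<And>b. b \<in> Basis \<Longrightarrow> l \<bullet> b \<le> u \<bullet> b"
  have lu: "Re l \<le> Re u" "Im l \<le> Im u"
    using le[of 1] le[of \<i>] by (simp_all add: Basis_complex_def)
  have "?g -` box l u = box (vector [Re l, Im l]) (vector [Re u, Im u])"
    by (auto simp: box_def Basis_complex_def Basis_vec_def forall_2 inner_axis vector_2)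
  then have "emeasure (distr lborel borel ?g) (box l u) =
      emeasure lborel (box (vector [Re l, Im l] :: real^2) (vector [Re u, Im u]))"
    by (simp add: emeasure_distr)
  also have "\<dots> = (\<Prod>b\<in>Basis. (vector [Re u, Im u] - vector [Re l, Im l] :: real^2) \<bullet> b)"
  proof (rule emeasure_lborel_box)
    have "\<forall>i. (vector [Re l, Im l] :: real^2) $ i \<le> vector [Re u, Im u] $ i"
      using lu by (simp add: forall_2 vector_2)
    then show "(vector [Re l, Im l] :: real^2) \<bullet> b \<le> vector [Re u, Im u] \<bullet> b" if "b \<in> Basis" for b
      using that by (auto simp: Basis_vec_def inner_axis)
  qed
  also have "(\<Prod>b\<in>Basis. (vector [Re u, Im u] - vector [Re l, Im l] :: real^2) \<bullet> b)
      = (\<Prod>i\<in>UNIV. (vector [Re u, Im u] - vector [Re l, Im l] :: real^2) $ i)"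
  proof -
    have B: "(Basis :: (real^2) set) = range (\<lambda>i. axis i 1)"
      by (auto simp: Basis_vec_def)
    have inj: "inj (\<lambda>i::2. axis i (1::real))"
      by (simp add: inj_on_def axis_eq_axis)
    show ?thesis
      unfolding B prod.reindex[OF inj] by (simp add: inner_axis)
  qed
  also have "\<dots> = (\<Prod>b\<in>Basis. (u - l) \<bullet> b)"
    by (simp add: UNIV_2 Basis_complex_def vector_2)
  finally show "emeasure (distr lborel borel ?g) (box l u) = (\<Prod>b\<in>Basis. (u - l) \<bullet> b)" .
qed simp

text \<open>In real coordinates, multiplication by a unimodular number is an orthogonal
  transformation. It is enough to compare the two measures on boxes.\<close>

lemma lborel_distr_rotation:
  fixes c :: complex
  assumes c: "norm c = 1"
  shows "distr lborel borel ((*) c) = lborel"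
proof (rule lborel_eqI[symmetric])
  let ?g = "\<lambda>v::real^2. Complex (v $ 1) (v $ 2)"
  have [measurable]: "?g \<in> borel_measurable borel" "(*) c \<in> borel_measurable borel"
    by (intro borel_measurable_continuous_onI; simp add: Complex_eq continuous_intros)+
  define T :: "real^2 \<Rightarrow> real^2" where "T v = vector [Re (cnj c * ?g v), Im (cnj c * ?g v)]" for v
  have gT: "?g (T v) = cnj c * ?g v" for v
    by (simp add: T_def complex_eq_iff vector_2)
  have cc: "c * (cnj c * w) = w" "cnj c * (c * w) = w" for w
    using c by (simp_all add: complex_norm_square[symmetric] mult.assoc[symmetric] mult.commute[of "cnj c" c])
  have normg: "norm (?g v) = norm v" for v
    by (simp add: norm_vec_def L2_set_def UNIV_2 cmod_def)
  have "norm (T v) = norm v" for v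
    by (subst normg[symmetric], subst gT) (simp add: norm_mult c normg)
  moreover have "linear T"
    by (rule linearI) (auto simp: T_def vec_eq_iff forall_2 vector_2 algebra_simps)
  ultimately have T: "orthogonal_transformation T"
    by (simp add: orthogonal_transformation)
  fix l u :: complex
  assume le: "\<And>b. b \<in> Basis \<Longrightarrow> l \<bullet> b \<le> u \<bullet> b"
  let ?S = "?g -` box l u"
  have ginj: "?g v = ?g w \<Longrightarrow> v = w" for v w
    by (simp add: vec_eq_iff forall_2)
  have im: "?g -` (*) c -` box l u = T ` ?S"
  proof (intro equalityI subsetI)
    fix v assume v: "v \<in> ?g -` (*) c -` box l u"
    define w :: "real^2" where "w = vector [Re (c * ?g v), Im (c * ?g v)]"
    have w: "?g w = c * ?g v" by (simp add: w_def complex_eq_iff vector_2)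
    have "?g (T w) = ?g v" unfolding gT w by (rule cc)
    then have "T w = v" by (rule ginj)
    moreover have "w \<in> ?S" using v w by simp
    ultimately show "v \<in> T ` ?S" by blast
  next
    fix v assume "v \<in> T ` ?S"
    then show "v \<in> ?g -` (*) c -` box l u" 
      by (auto simp only: gT cc vimage_eq)
  qed
  have S: "emeasure lborel ?S = emeasure lborel (box l u)"
    by (subst lborel_complex_eq_distr_vec) (simp add: emeasure_distr)
  have Sb: "?S \<in> sets borel" "T ` ?S \<in> sets borel"
    unfolding im[symmetric]
    using measurable_sets[of ?g borel borel "box l u"]
      measurable_sets[of ?g borel borel "(*) c -` box l u"] measurable_sets[of "(*) c" borel borel "box l u"]
    by simp_all
  \<comment> \<open>Finiteness of the measure lets the invariance of the real-valued
    \<open>measure\<close> pass to \<open>emeasure\<close>.\<close>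
  have Sm: "?S \<in> lmeasurable"
    by (rule fmeasurableI) (use S Sb emeasure_lborel_box_finite[of l u] in auto)
  have "emeasure (distr lborel borel ((*) c)) (box l u) = emeasure lborel (T ` ?S)"
    unfolding im[symmetric]
    using measurable_sets[of "(*) c" borel borel "box l u"]
    by (subst lborel_complex_eq_distr_vec) (simp add: emeasure_distr)
  also have "\<dots> = emeasure lebesgue (T ` ?S)" using Sb by simp
  also have "\<dots> = emeasure lebesgue ?S"
    using measurable_orthogonal_image[OF T Sm] measure_orthogonal_image[OF T Sm] Sm
    by (simp add: emeasure_eq_measure2)
  also have "\<dots> = emeasure lborel (box l u)" using S Sb by simp
  finally show "emeasure (distr lborel borel ((*) c)) (box l u) = (\<Prod>b\<in>Basis. (u - l) \<bullet> b)"
    using le by simp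
qed simp

section \<open>Mean value inequalities for holomorphic functions\<close>

text \<open>Cauchy's integral formula writes \<open>f 0\<close> as the mean of \<open>f\<close> over
  the circle through \<open>z\<close>, and the norm moves under the integral. Naming the circle by a
  point \<open>z\<close> rather than by its radius makes the inequality ready to be integrated over
  \<open>z\<close> in a disc.\<close>

lemma holomorphic_norm_le_circle_average:
  fixes f :: "complex \<Rightarrow> complex"
  assumes hol: "f holomorphic_on ball 0 r" and z: "norm z < r"
  shows "ennreal (norm (f 0)) \<le>
    (\<integral>\<^sup>+t. indicator {0..1} t * ennreal (norm (f (exp (2 * of_real pi * \<i> * of_real t) * z))) \<partial>lborel)"
proof -
  \<comment> \<open>Rescaling by \<open>z\<close> moves the circle to the unit circle and also
    covers \<open>z = 0\<close>.\<close>
  define k where "k = (\<lambda>u. f (u * z))"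
  have sub: "u * z \<in> ball 0 r" if "norm u \<le> 1" for u
    using that z mult_right_mono[OF that norm_ge_zero[of z]] by (simp add: norm_mult)
  have hk: "k holomorphic_on cball 0 1"
    unfolding k_def
    by (rule holomorphic_on_compose_gen[OF _ hol, of "\<lambda>u. u * z", unfolded o_def])
       (use sub in \<open>auto intro!: holomorphic_intros\<close>)
  let ?e = "\<lambda>t::real. exp (2 * of_real pi * \<i> * of_real t)"
  have ne: "norm (?e t) = 1" for t by (simp add: norm_exp_eq_Re)
  have "((\<lambda>u. k u / (u - 0)) has_contour_integral 2 * of_real pi * \<i> * k 0) (circlepath 0 1)"
    by (rule Cauchy_integral_circlepath_simple[OF hk]) simp
  then have "((\<lambda>t. k (?e t) / ?e t * (2 * pi * \<i> * ?e t)) has_integral 2 * of_real pi * \<i> * k 0) {0..1}"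
    unfolding has_contour_integral_def
    by (rule has_integral_eq[rotated])
       (simp add: vector_derivative_circlepath01, simp add: circlepath)
  \<comment> \<open>The factor \<open>?e t\<close> in the velocity of the circle cancels the
    denominator of the Cauchy kernel.\<close>
  then have "((\<lambda>t. (2 * pi * \<i>) * k (?e t)) has_integral (2 * pi * \<i>) * k 0) {0..1}"
    by (simp add: mult_ac)
  from has_integral_mult_right[OF this, of "1 / (2 * pi * \<i>)"]
  have I: "((\<lambda>t. k (?e t)) has_integral k 0) {0..1}"
    by simp
  have "continuous_on {0..1} (\<lambda>t. k (?e t))"
    by (rule continuous_on_compose2[OF holomorphic_on_imp_continuous_on[OF hk]])
       (auto intro!: continuous_intros simp: ne)
  then have "continuous_on {0..1} (\<lambda>t. norm (k (?e t)))"
    by (rule continuous_on_norm)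
  then have J: "(\<lambda>t. norm (k (?e t))) integrable_on {0..1}"
    by (rule integrable_continuous_interval)
  have "norm (k 0) \<le> integral {0..1} (\<lambda>t. norm (k (?e t)))"
    using integral_norm_bound_integral[of "\<lambda>t. k (?e t)" "{0..1}" "\<lambda>t. norm (k (?e t))"] I J
    by (simp add: has_integral_integrable integral_unique)
  moreover have "(\<integral>\<^sup>+t. ennreal (indicator {0..1} t * norm (k (?e t))) \<partial>lborel) =
      ennreal (integral {0..1} (\<lambda>t. norm (k (?e t))))"
    by (rule nn_integral_has_integral_lebesgue) (use J in \<open>auto intro: integrable_integral\<close>)
  ultimately show ?thesis
    by (simp add: k_def ennreal_mult' ennreal_indicator ennreal_leI)
qed

text \<open>Integrating the circle average over the disc and exchanging the integrals, rotation invariance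
  of \<open>lborel\<close> makes polar coordinates unnecessary.\<close>
lemma holomorphic_norm_le_area_average:
  fixes f :: "complex \<Rightarrow> complex"
  assumes hol: "f holomorphic_on ball 0 r"
  shows "ennreal (norm (f 0)) * emeasure lborel (ball (0::complex) r) \<le>
    (\<integral>\<^sup>+z\<in>ball 0 r. ennreal (norm (f z)) \<partial>lborel)"
proof -
  let ?e = "\<lambda>t::real. exp (2 * of_real pi * \<i> * of_real t)"
  have ne: "norm (?e t) = 1" for t by (simp add: norm_exp_eq_Re)
  define F where "F = (\<lambda>z. ennreal (norm (f z)) * indicator (ball 0 r) z)"
  \<comment> \<open>Nothing is known about \<open>f\<close> outside the disc, so its extension by
    zero is used to get a globally Borel function.\<close>
  have "(\<lambda>z. indicator (ball 0 r) z *\<^sub>R f z) \<in> borel_measurable borel"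
    by (rule borel_measurable_continuous_on_indicator[OF _ holomorphic_on_imp_continuous_on[OF hol]]) simp
  then have "(\<lambda>z. ennreal (norm (indicator (ball 0 r) z *\<^sub>R f z))) \<in> borel_measurable borel"
    by measurable
  also have "(\<lambda>z. ennreal (norm (indicator (ball 0 r) z *\<^sub>R f z))) = F"
    by (auto simp: F_def indicator_def)
  finally have F[measurable]: "F \<in> borel_measurable borel" .
  have [measurable]: "?e \<in> borel_measurable borel"
    by (intro borel_measurable_continuous_onI continuous_intros)
  have "ennreal (norm (f 0)) * emeasure lborel (ball (0::complex) r) =
      (\<integral>\<^sup>+z. ennreal (norm (f 0)) * indicator (ball (0::complex) r) z \<partial>lborel)"
    by (simp add: nn_integral_cmult_indicator)
  also have "\<dots> \<le> (\<integral>\<^sup>+z. (\<integral>\<^sup>+t. indicator {0..1} t * F (?e t * z) \<partial>lborel) \<partial>lborel)"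
  proof (rule nn_integral_mono)
    fix z :: complex
    show "ennreal (norm (f 0)) * indicator (ball (0::complex) r) z \<le>
        (\<integral>\<^sup>+t. indicator {0..1} t * F (?e t * z) \<partial>lborel)"
    proof (cases "norm z < r")
      case True
      then show ?thesis
        using holomorphic_norm_le_circle_average[OF hol True] by (simp add: F_def norm_mult ne)
    qed simp
  qed
  also have "\<dots> = (\<integral>\<^sup>+t. (\<integral>\<^sup>+z. indicator {0..1} t * F (?e t * z) \<partial>lborel) \<partial>lborel)"
    by (rule lborel_pair.Fubini') measurable
  also have "\<dots> = (\<integral>\<^sup>+t. indicator {0..1} t * (\<integral>\<^sup>+z. F z \<partial>lborel) \<partial>(lborel :: real measure))"
  proof (rule nn_integral_cong)
    fix t :: real
    have "(\<integral>\<^sup>+z. F z \<partial>lborel) = (\<integral>\<^sup>+z. F z \<partial>distr lborel borel ((*) (?e t)))"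
      by (simp only: lborel_distr_rotation[OF ne])
    also have "\<dots> = (\<integral>\<^sup>+z. F (?e t * z) \<partial>lborel)"
      by (rule nn_integral_distr) (auto intro!: borel_measurable_continuous_onI continuous_intros)
    finally show "(\<integral>\<^sup>+z. indicator {0..1} t * F (?e t * z) \<partial>lborel) = indicator {0..1} t * (\<integral>\<^sup>+z. F z \<partial>lborel)"
      by (simp add: nn_integral_cmult)
  qed
  also have "\<dots> = (\<integral>\<^sup>+z. F z \<partial>lborel)"
    by (simp add: nn_integral_multc)
  finally show ?thesis by (simp add: F_def)
qed

section \<open>Pointwise growth from \<open>s\<close>-integrability\<close>

text \<open>Below the threshold \<open>l\<close> the first term suffices; above it, \<open>a\<close>
  may be multiplied by \<open>(a / l) powr (s - 1)\<close>, which is at least 1. Choosing the free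
  parameter \<open>l\<close> later replaces an appeal to Hoelder's inequality.\<close>

lemma powr_Young:
  fixes a l s :: real
  assumes "0 \<le> a" "0 < l" "1 \<le> s"
  shows "a \<le> l + l powr (1 - s) * a powr s"
proof (cases "a \<le> l")
  case True
  then show ?thesis by (simp add: add_increasing2)
next
  case False
  with assms have a: "a > 0" by simp
  have "a * 1 \<le> a * (a / l) powr (s - 1)"
    using False assms by (intro mult_left_mono ge_one_powr_ge_zero) auto
  also have "\<dots> = l powr (1 - s) * a powr s"
    using a assms by (simp add: powr_divide powr_diff field_simps)
  finally show ?thesis using assms by simp
qed

lemma holomorphic_Ls_growth:
  fixes f :: "complex \<Rightarrow> complex" and s :: real
  assumes hol: "f holomorphic_on ball 0 1" and s: "1 \<le> s"
    and fin: "(\<integral>\<^sup>+z\<in>ball 0 1. ennreal (norm (f z) powr s) \<partial>lborel) < \<infinity>"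
  obtains C where "0 \<le> C" "\<And>z. norm z < 1 \<Longrightarrow> norm (f z) \<le> C * (1 - norm z) powr -(2/s)"
proof -
  obtain I where I: "(\<integral>\<^sup>+z\<in>ball 0 1. ennreal (norm (f z) powr s) \<partial>lborel) = ennreal I" "0 \<le> I"
    using fin by (cases "\<integral>\<^sup>+z\<in>ball 0 1. ennreal (norm (f z) powr s) \<partial>lborel" rule: ennreal_cases) auto
  have "norm (f w) \<le> (1 + I / pi) * (1 - norm w) powr -(2/s)" if w: "norm w < 1" for w
  proof -
    define r where "r = 1 - norm w"
    \<comment> \<open>\<open>l\<close> is the size of the desired bound. It balances Young's
      inequality integrated over a disc of area \<open>pi * r^2\<close>: the first term gives
      \<open>l * pi * r^2\<close>, and \<open>l powr (1 - s)\<close> equals \<open>r^2 * l\<close>.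
      Dividing by the area yields the constant \<open>1 + I / pi\<close>.\<close>
    define l where "l = r powr -(2/s)"
    have r: "r > 0" and l: "l > 0" using w by (auto simp: r_def l_def)
    have sub: "ball w r \<subseteq> ball 0 1" 
      by (simp add: r_def ball_subset_ball_iff dist_norm)
    have area: "emeasure lborel (ball c r) = ennreal (pi * r\<^sup>2)" for c :: complex
      using r by (simp add: emeasure_ball unit_ball_vol_2)
    have [measurable]: "(\<lambda>z. indicator (ball 0 1) z *\<^sub>R f z) \<in> borel_measurable borel"
      by (rule borel_measurable_continuous_on_indicator[OF _ holomorphic_on_imp_continuous_on[OF hol]]) simp
    \<comment> \<open>Again extension by zero, for measurability on the whole plane.\<close>
    define G where "G z = norm (indicator (ball 0 1) z *\<^sub>R f z)" for z
    have [measurable]: "G \<in> borel_measurable borel" unfolding G_def by measurable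
    have G: "G z = norm (f z)" if "z \<in> ball 0 1" for z using that by (simp add: G_def)
    \<comment> \<open>The area inequality is centred at 0, so it is applied to a translate of
      \<open>f\<close>; translation invariance of \<open>lborel\<close> then moves the disc back to
      \<open>w\<close>.\<close>
    have "ennreal (norm (f w)) * ennreal (pi * r\<^sup>2) \<le>
        (\<integral>\<^sup>+z\<in>ball 0 r. ennreal (norm (f (w + z))) \<partial>lborel)"
    proof -
      have "(\<lambda>z. f (w + z)) holomorphic_on ball 0 r"
        by (rule holomorphic_on_compose_gen[OF _ hol, of "\<lambda>z. w + z", unfolded o_def])
           (use sub in \<open>auto intro!: holomorphic_intros simp: subset_eq dist_norm\<close>)
      then show ?thesis
        using holomorphic_norm_le_area_average[of "\<lambda>z. f (w + z)" r] by (simp add: area)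
    qed
    also have "\<dots> = (\<integral>\<^sup>+z. ennreal (G (w + z)) * indicator (ball w r) (w + z) \<partial>lborel)"
    proof (rule nn_integral_cong)
      fix z
      have "w + z \<in> ball 0 1" if "norm z < r"
        using that by (intro subsetD[OF sub]) (simp add: dist_norm)
      then show "ennreal (norm (f (w + z))) * indicator (ball 0 r) z =
          ennreal (G (w + z)) * indicator (ball w r) (w + z)"
        by (auto simp: indicator_def G dist_norm)
    qed
    also have "\<dots> = (\<integral>\<^sup>+z. ennreal (G z) * indicator (ball w r) z \<partial>distr lborel borel ((+) w))"
    proof (rule nn_integral_distr[symmetric])
      show "(\<lambda>z. ennreal (G z) * indicator (ball w r) z) \<in> borel_measurable (distr lborel borel ((+) w))"
        by (intro borel_measurable_times_ennreal borel_measurable_indicator) measurable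
    qed simp
    also have "\<dots> = (\<integral>\<^sup>+z. ennreal (G z) * indicator (ball w r) z \<partial>lborel)"
      by (simp add: lborel_distr_plus)
    \<comment> \<open>In the second term the small disc is enlarged to the unit disc, so that its
      integral is at most \<open>I\<close>, whatever \<open>w\<close> is.\<close>
    also have "\<dots> \<le> (\<integral>\<^sup>+z. ennreal l * indicator (ball w r) z +
        ennreal (l powr (1 - s)) * (ennreal (G z powr s) * indicator (ball 0 1) z) \<partial>lborel)"
    proof (rule nn_integral_mono)
      fix z
      have "ennreal (G z) \<le> ennreal (l + l powr (1 - s) * G z powr s)"
        using l s by (intro ennreal_leI powr_Young) (auto simp: G_def)
      also have "\<dots> = ennreal l + ennreal (l powr (1 - s)) * ennreal (G z powr s)"
        using l by (simp add: ennreal_mult)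
      finally show "ennreal (G z) * indicator (ball w r) z \<le> ennreal l * indicator (ball w r) z +
        ennreal (l powr (1 - s)) * (ennreal (G z powr s) * indicator (ball 0 1) z)"
        using sub by (auto simp: indicator_def)
    qed
    also have "\<dots> = ennreal l * ennreal (pi * r\<^sup>2) + ennreal (l powr (1 - s)) *
        (\<integral>\<^sup>+z. ennreal (G z powr s) * indicator (ball 0 1) z \<partial>lborel)"
    proof -
      have ind: "indicator (ball c q) \<in> borel_measurable lborel" for c :: complex and q
        by (rule borel_measurable_indicator) simp
      have m1: "(\<lambda>z. ennreal l * indicator (ball w r) z) \<in> borel_measurable lborel"
        by (intro borel_measurable_times_ennreal ind) simp
      have m2: "(\<lambda>z. ennreal (G z powr s) * indicator (ball 0 1) z) \<in> borel_measurable lborel"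
        by (intro borel_measurable_times_ennreal ind) simp
      have m3: "(\<lambda>z. ennreal (l powr (1 - s)) * (ennreal (G z powr s) * indicator (ball 0 1) z)) \<in> borel_measurable lborel"
        by (intro borel_measurable_times_ennreal m2) simp
      show ?thesis
        by (simp only: nn_integral_add[OF m1 m3] nn_integral_cmult[OF m2])
           (simp add: nn_integral_cmult_indicator area)
    qed
    also have "(\<integral>\<^sup>+z. ennreal (G z powr s) * indicator (ball 0 1) z \<partial>lborel) = ennreal I"
      unfolding I(1)[symmetric] by (intro nn_integral_cong) (auto simp: indicator_def G)
    finally have "ennreal (norm (f w) * (pi * r\<^sup>2)) \<le> ennreal (l * (pi * r\<^sup>2) + l powr (1 - s) * I)"
      using l r I(2) by (simp add: ennreal_mult)
    then have A: "norm (f w) * (pi * r\<^sup>2) \<le> l * (pi * r\<^sup>2) + l powr (1 - s) * I"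
      using l r I(2) by (subst (asm) ennreal_le_iff) auto
    have "l powr (1 - s) = r powr (2 + -(2/s))"
    proof -
      have "-(2/s) * (1 - s) = 2 + -(2/s)" using s by (simp add: field_simps)
      then show ?thesis by (simp only: l_def powr_powr)
    qed
    also have "\<dots> = r\<^sup>2 * l"
      using r by (simp only: powr_add l_def) simp
    finally have "l * (pi * r\<^sup>2) + l powr (1 - s) * I = ((1 + I / pi) * l) * (pi * r\<^sup>2)"
      by (simp add: field_simps)
    with A have "norm (f w) * (pi * r\<^sup>2) \<le> ((1 + I / pi) * l) * (pi * r\<^sup>2)"
      by simp
    then show ?thesis
      using r by (simp add: l_def r_def)
  qed
  with I(2) show ?thesis
    by (intro that[of "1 + I / pi"]) auto
qed

section \<open>Lipschitz curves are rectifiable and absolutely continuous\<close>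

text \<open>One estimate for both conditions on admissible curves: the total length on the right is
  1 for a division of \<open>{0..1}\<close> and small in the test for absolute continuity.\<close>

lemma lipschitz_division_sum_le:
  fixes \<gamma> :: "real \<Rightarrow> complex"
  assumes L: "L-lipschitz_on {0..1} \<gamma>" and D: "\<D> division_of T" and T: "T \<subseteq> {0..1}"
  shows "(\<Sum>K\<in>\<D>. norm (\<gamma> (Sup K) - \<gamma> (Inf K))) \<le> L * (\<Sum>K\<in>\<D>. Sup K - Inf K)"
  unfolding sum_distrib_left
proof (rule sum_mono)
  fix K assume K: "K \<in> \<D>"
  obtain a b where ab: "K = cbox a b" using division_ofD(4)[OF D K] by blast
  have le: "a \<le> b" using division_ofD(3)[OF D K] ab by auto
  have "K \<subseteq> {0..1}" using division_ofD(2)[OF D K] T by blast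
  then have "a \<in> {0..1}" "b \<in> {0..1}" using ab le by auto
  then show "norm (\<gamma> (Sup K) - \<gamma> (Inf K)) \<le> L * (Sup K - Inf K)"
    using lipschitz_onD[OF L, of b a] le by (simp add: ab dist_norm)
qed

lemma lipschitz_imp_rectifiable_path:
  assumes L: "L-lipschitz_on {0..1} \<gamma>"
  shows "rectifiable_path \<gamma>"
  unfolding rectifiable_path_def
proof (intro conjI exI allI impI)
  show "path \<gamma>"
    unfolding path_def by (rule lipschitz_on_continuous_on[OF L])
  fix \<D> :: "real set set" assume D: "\<D> division_of {0..1}"
  \<comment> \<open>Written as measures, the lengths add up to that of
    \<open>{0..1}\<close>.\<close>
  have "(\<Sum>K\<in>\<D>. Sup K - Inf K) = (\<Sum>K\<in>\<D>. measure lborel K)"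
  proof (rule sum.cong[OF refl])
    fix K assume K: "K \<in> \<D>"
    obtain a b where "K = cbox a b" using division_ofD(4)[OF D K] by blast
    then show "Sup K - Inf K = measure lborel K" using division_ofD(3)[OF D K] by auto
  qed
  also have "\<dots> = 1"
    using additive_content_division[of \<D> 0 "1::real"] D by simp
  finally show "(\<Sum>K\<in>\<D>. norm (\<gamma> (Sup K) - \<gamma> (Inf K))) \<le> L"
    using lipschitz_division_sum_le[OF L D] by simp
qed

lemma lipschitz_imp_absolutely_continuous_path:
  assumes L: "L-lipschitz_on {0..1} \<gamma>"
  shows "absolutely_continuous_path \<gamma>"
  unfolding absolutely_continuous_path_def
proof (intro allI impI)
  fix \<epsilon> :: real assume e: "\<epsilon> > 0"
  have L0: "0 \<le> L" by (rule lipschitz_on_nonneg[OF L])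
  show "\<exists>\<delta>>0. \<forall>\<D> T. \<D> division_of T \<and> T \<subseteq> {0..1} \<and> (\<Sum>K\<in>\<D>. Sup K - Inf K) < \<delta> \<longrightarrow>
      (\<Sum>K\<in>\<D>. norm (\<gamma> (Sup K) - \<gamma> (Inf K))) < \<epsilon>"
  proof (intro exI conjI allI impI)
    \<comment> \<open>Adding 1 covers \<open>L = 0\<close> and makes the final inequality
      strict.\<close>
    show "\<epsilon> / (L + 1) > 0" using e L0 by simp
    fix \<D> T assume *: "\<D> division_of T \<and> T \<subseteq> {0..1} \<and> (\<Sum>K\<in>\<D>. Sup K - Inf K) < \<epsilon> / (L + 1)"
    then have "(\<Sum>K\<in>\<D>. norm (\<gamma> (Sup K) - \<gamma> (Inf K))) \<le> L * (\<Sum>K\<in>\<D>. Sup K - Inf K)"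
      by (intro lipschitz_division_sum_le[OF L]) auto
    also have "\<dots> \<le> L * (\<epsilon> / (L + 1))"
      using * L0 by (intro mult_left_mono) auto
    also have "\<dots> < \<epsilon>" using e L0 by (simp add: field_simps)
    finally show "(\<Sum>K\<in>\<D>. norm (\<gamma> (Sup K) - \<gamma> (Inf K))) < \<epsilon>" .
  qed
qed

section \<open>Broken paths through the origin and the length of their images\<close>

text \<open>Up to a factor, this is the function that will dominate the speed of the image curves.
  Either end point may lie close to the unit circle, so blow-up is allowed at both ends; the second
  summand is the reflection of the first.\<close>

lemma has_integral_powr_endpoints:
  fixes a :: real
  assumes a: "a < 1"
  shows "((\<lambda>t. t powr (-a) + (1 - t) powr (-a)) has_integral 2 / (1 - a)) {0..1}"
proof -
  have 1: "((\<lambda>t. t powr (-a)) has_integral 1 / (1 - a)) {0..1::real}"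
    using has_integral_powr_from_0[of "-a" 1] a by simp
  have "(\<lambda>x::real. 1 - x) ` {0..1} = {0..1}"
    by (auto simp: image_iff intro!: bexI[of _ "1 - _"])
  then have 2: "((\<lambda>t. (1 - t) powr (-a)) has_integral 1 / (1 - a)) {0..1::real}"
    using has_integral_affinity[of "\<lambda>t. t powr (-a)" "1 / (1 - a)" 0 1 "-1" 1] 1 by simp
  show ?thesis using has_integral_add[OF 1 2] by simp
qed

text \<open>The broken path from \<open>x\<close> to 0 to \<open>y\<close>, with its corner at time
  1/2. Truncation by \<open>max 0\<close> joins both halves in one formula.\<close>

definition bent_path :: "complex \<Rightarrow> complex \<Rightarrow> real \<Rightarrow> complex" where
  "bent_path x y t = max 0 (1 - 2 * t) *\<^sub>R x + max 0 (2 * t - 1) *\<^sub>R y"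

text \<open>At each time at least one summand vanishes, and the other weight is at most
  \<open>\<bar>1 - 2 * t\<bar>\<close>. Taking \<open>r < 1\<close> confines the path to a compact
  disc; taking \<open>r = 1\<close> gives a bound independent of the end points.\<close>

lemma norm_bent_path_le:
  assumes "norm x \<le> r" "norm y \<le> r"
  shows "norm (bent_path x y t) \<le> \<bar>1 - 2 * t\<bar> * r"
proof (cases "t \<le> 1/2")
  case True
  then show ?thesis using assms by (simp add: bent_path_def mult_left_mono)
next
  case False
  then show ?thesis using assms by (simp add: bent_path_def mult_left_mono)
qed

lemma bent_path_lipschitz:
  "(2 * (norm x + norm y))-lipschitz_on S (bent_path x y)"
proof (rule lipschitz_onI)
  fix t u
  have "norm (bent_path x y t - bent_path x y u) =
      norm ((max 0 (1 - 2 * t) - max 0 (1 - 2 * u)) *\<^sub>R x + (max 0 (2 * t - 1) - max 0 (2 * u - 1)) *\<^sub>R y)"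
    by (simp add: bent_path_def algebra_simps)
  also have "\<dots> \<le> \<bar>max 0 (1 - 2 * t) - max 0 (1 - 2 * u)\<bar> * norm x + \<bar>max 0 (2 * t - 1) - max 0 (2 * u - 1)\<bar> * norm y"
    by (rule norm_triangle_le) simp
  \<comment> \<open>\<open>max 0\<close> is 1-Lipschitz, so each weight is 2-Lipschitz.\<close>
  also have "\<dots> \<le> (2 * \<bar>t - u\<bar>) * norm x + (2 * \<bar>t - u\<bar>) * norm y"
    by (intro add_mono mult_right_mono) (auto simp: max_def abs_if)
  finally show "dist (bent_path x y t) (bent_path x y u) \<le> 2 * (norm x + norm y) * dist t u"
    by (simp add: dist_norm algebra_simps)
qed simp

lemma bent_path_has_vector_derivative:
  assumes "t \<noteq> 1/2"
  shows "(bent_path x y has_vector_derivative (if t < 1/2 then - 2 *\<^sub>R x else 2 *\<^sub>R y)) (at t)"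
proof (cases "t < 1/2")
  case True
  have "((\<lambda>t. (1 - 2 * t) *\<^sub>R x) has_vector_derivative - 2 *\<^sub>R x) (at t)"
    by (auto intro!: derivative_eq_intros simp: has_vector_derivative_def)
  then have "(bent_path x y has_vector_derivative - 2 *\<^sub>R x) (at t)"
    by (rule has_vector_derivative_transform_within_open[of _ _ _ "{..<1/2}"])
       (use True in \<open>auto simp: bent_path_def\<close>)
  then show ?thesis using True by simp
next
  case False
  have "((\<lambda>t. (2 * t - 1) *\<^sub>R y) has_vector_derivative 2 *\<^sub>R y) (at t)"
    by (auto intro!: derivative_eq_intros simp: has_vector_derivative_def)
  then have "(bent_path x y has_vector_derivative 2 *\<^sub>R y) (at t)"
    by (rule has_vector_derivative_transform_within_open[of _ _ _ "{1/2<..}"])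
       (use False assms in \<open>auto simp: bent_path_def\<close>)
  then show ?thesis using False by simp
qed

text \<open>The growth bound is used twice on the image of a broken path. On a compact disc it makes
  \<open>f\<close> Lipschitz, with a constant depending on \<open>x\<close> and \<open>y\<close>;
  this serves only to make the curve admissible. Along the path it bounds the speed by an integrable
  function independent of \<open>x\<close> and \<open>y\<close>.\<close>

lemma geodesic_dist_le_of_deriv_growth:
  fixes f :: "complex \<Rightarrow> complex" and a C :: real
  assumes hol: "f holomorphic_on ball 0 1" and im: "f ` ball 0 1 \<subseteq> \<Omega>"
    and a: "0 \<le> a" "a < 1" and C: "0 \<le> C"
    and growth: "\<And>z. norm z < 1 \<Longrightarrow> norm (deriv f z) \<le> C * (1 - norm z) powr (-a)"
    and x: "norm x < 1" and y: "norm y < 1"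
  shows "geodesic_dist \<Omega> (f x) (f y) \<le> ennreal (4 * C / (1 - a))"
proof -
  define \<gamma> where "\<gamma> = f \<circ> bent_path x y"
  define r where "r = max (norm x) (norm y)"
  have r: "r < 1" "norm x \<le> r" "norm y \<le> r" "0 \<le> r" using x y by (auto simp: r_def max_def)
  have bp: "norm (bent_path x y t) \<le> r" if "t \<in> {0..1}" for t
  proof -
    have "\<bar>1 - 2 * t\<bar> * r \<le> 1 * r" using that r by (intro mult_right_mono) auto
    then show ?thesis using norm_bent_path_le[OF r(2,3), of t] by simp
  qed
  have der: "(f has_field_derivative deriv f z) (at z)" if "norm z < 1" for z
    using that by (intro holomorphic_derivI[OF hol]) auto
  have "(C * (1 - r) powr (-a))-lipschitz_on (cball 0 r) f"
  proof (rule lipschitz_onI)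
    fix u v :: complex assume uv: "u \<in> cball 0 r" "v \<in> cball 0 r"
    have "norm (f u - f v) \<le> C * (1 - r) powr (-a) * norm (u - v)"
    proof (rule field_differentiable_bound[where S = "cball 0 r" and f' = "deriv f"])
      fix z :: complex assume z: "z \<in> cball 0 r"
      show "(f has_field_derivative deriv f z) (at z within cball 0 r)"
        using z r by (intro has_field_derivative_at_within[OF der]) auto
      have "norm (deriv f z) \<le> C * (1 - norm z) powr (-a)"
        using z r by (intro growth) auto
      also have "\<dots> \<le> C * (1 - r) powr (-a)"
        using z r a C by (intro mult_left_mono powr_mono2') auto
      finally show "norm (deriv f z) \<le> C * (1 - r) powr (-a)" .
    qed (use uv in auto)
    then show "dist (f u) (f v) \<le> C * (1 - r) powr (-a) * dist u v"
      by (simp add: dist_norm)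
  qed (use C in simp)
  then have "(C * (1 - r) powr (-a))-lipschitz_on (bent_path x y ` {0..1}) f"
    by (rule lipschitz_on_subset) (use bp in auto)
  then have L: "(C * (1 - r) powr (-a) * (2 * (norm x + norm y)))-lipschitz_on {0..1} \<gamma>"
    unfolding \<gamma>_def by (intro lipschitz_on_compose bent_path_lipschitz)
  have "path_length \<gamma> \<le> (\<integral>\<^sup>+t. ennreal (indicator {0..1} t * (2 * C * (t powr (-a) + (1 - t) powr (-a)))) \<partial>lebesgue)"
    unfolding path_length_def
  proof (rule nn_integral_mono_AE)
    \<comment> \<open>Three times are discarded: the corner 1/2, and the ends 0 and 1, where
      \<open>0 powr (-a)\<close> has the default value 0 and may be too small to dominate.\<close>
    have "AE t in lebesgue. t \<noteq> a" for a :: real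
      by (rule AE_completion[OF AE_lborel_singleton])
    from this[of 0] this[of "1/2"] this[of 1]
    show "AE t in lebesgue. ennreal (norm (vector_derivative \<gamma> (at t))) * indicator {0..1} t
        \<le> ennreal (indicator {0..1} t * (2 * C * (t powr (-a) + (1 - t) powr (-a))))"
    proof eventually_elim
      case (elim t)
      show ?case
      proof (cases "t \<in> {0..1}")
        case True
        then have t: "0 < t" "t < 1" "t \<noteq> 1/2" using elim by auto
        let ?z = "bent_path x y t"
        let ?d = "if t < 1/2 then - 2 *\<^sub>R x else 2 *\<^sub>R y"
        have z: "norm ?z < 1" using bp[OF True] r by simp
        have "(\<gamma> has_vector_derivative ?d * deriv f ?z) (at t)"
          unfolding \<gamma>_def
          by (rule field_vector_diff_chain_at[OF bent_path_has_vector_derivative[OF t(3)] der[OF z]])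
        then have "norm (vector_derivative \<gamma> (at t)) = norm ?d * norm (deriv f ?z)"
          by (simp add: vector_derivative_at norm_mult)
        \<comment> \<open>The factor 2 arises because each half is traversed in half the
          time.\<close>
        also have "\<dots> \<le> 2 * (C * (1 - norm ?z) powr (-a))"
          using growth[OF z] x y by (intro mult_mono) auto
        also have "\<dots> \<le> 2 * (C * min t (1 - t) powr (-a))"
        proof -
          \<comment> \<open>The distance to the unit circle is thus at least
            \<open>1 - \<bar>1 - 2 * t\<bar>\<close>, which is twice \<open>min t (1 - t)\<close>;
            the factor 2 is given away.\<close>
          have "norm ?z \<le> \<bar>1 - 2 * t\<bar>"
            using norm_bent_path_le[of x 1 y t] x y by simp
          then have "min t (1 - t) \<le> 1 - norm ?z" using t by auto
          then show ?thesis using t a C by (intro mult_left_mono powr_mono2') auto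
        qed
        also have "\<dots> \<le> 2 * C * (t powr (-a) + (1 - t) powr (-a))"
          using C by (auto simp: min_def intro!: mult_left_mono)
        finally show ?thesis using True by (simp add: ennreal_leI)
      qed simp
    qed
  qed
  also have "\<dots> = (\<integral>\<^sup>+t. ennreal (indicator {0..1} t * (2 * C * (t powr (-a) + (1 - t) powr (-a)))) \<partial>lborel)"
    by (rule nn_integral_completion)
  also have "\<dots> = ennreal (2 * C * (2 / (1 - a)))"
    by (rule nn_integral_has_integral_lebesgue)
       (use C has_integral_mult_right[OF has_integral_powr_endpoints[OF a(2)], of "2 * C"] in auto)
  finally have len: "path_length \<gamma> \<le> ennreal (4 * C / (1 - a))" by simp
  have "path_image \<gamma> \<subseteq> \<Omega>"
  proof -
    have "bent_path x y t \<in> ball 0 1" if "t \<in> {0..1}" for t using bp[OF that] r by simp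
    then show ?thesis using im by (auto simp: path_image_def \<gamma>_def)
  qed
  moreover have "pathstart \<gamma> = f x" "pathfinish \<gamma> = f y"
    by (simp_all add: \<gamma>_def pathstart_def pathfinish_def bent_path_def)
  ultimately show ?thesis
    unfolding geodesic_dist_def
    using lipschitz_imp_rectifiable_path[OF L] lipschitz_imp_absolutely_continuous_path[OF L] len
    by (intro INF_lower2[of \<gamma>]) auto
qed

theorem theorem1p2:
  fixes \<Omega> :: "complex set" and \<phi> :: "complex \<Rightarrow> complex" and s :: real
  assumes "domain_in_C \<Omega>"
    and "conformal_homeomorphism (ball 0 1) \<Omega> \<phi>"
    and "s > 2"
    and "(\<integral>\<^sup>+z\<in>ball 0 1. ennreal (cmod (deriv \<phi> z) powr s) \<partial>lborel) < \<infinity>"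
  shows "geodesic_diameter \<Omega> < \<infinity>"
proof -
  have hol: "\<phi> holomorphic_on ball 0 1" and im: "\<phi> ` ball 0 1 = \<Omega>"
    using assms(2) by (simp_all add: conformal_homeomorphism_iff)
  have "deriv \<phi> holomorphic_on ball 0 1"
    using hol by (rule holomorphic_deriv) simp
  then obtain C where C: "0 \<le> C"
    and growth: "\<And>z. norm z < 1 \<Longrightarrow> norm (deriv \<phi> z) \<le> C * (1 - norm z) powr -(2/s)"
    using holomorphic_Ls_growth[of "deriv \<phi>" s] assms(3,4) by auto
  \<comment> \<open>With \<open>a = 2/s\<close>, the assumption \<open>s > 2\<close> gives
    \<open>a < 1\<close>. The bound is the same for all \<open>u\<close> and \<open>v\<close>, so it
    survives both suprema.\<close>
  have "geodesic_dist \<Omega> u v \<le> ennreal (4 * C / (1 - 2/s))" if uv: "u \<in> \<Omega>" "v \<in> \<Omega>" for u v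
  proof -
    obtain x y where "x \<in> ball 0 1" "y \<in> ball 0 1" "u = \<phi> x" "v = \<phi> y"
      using uv im by blast
    then show ?thesis
      using geodesic_dist_le_of_deriv_growth[OF hol equalityD1[OF im] _ _ C growth] assms(3) by simp
  qed
  then have "geodesic_diameter \<Omega> \<le> ennreal (4 * C / (1 - 2/s))"
    unfolding geodesic_diameter_def by (intro SUP_least)
  then show ?thesis
    by (rule le_less_trans) simp
qed

end
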